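(* Let $n$ be a positive integer. The power series $I_p(x)\in 1+x\mathbb Q[[x]]$, $0\le p\le n-1$, defined by $I_p(x)=(\mathbf M^p\mathcal F)(0,x)$, satisfy $$I_0(x)\,I_1(x)\cdots I_{n-1}(x)=(1-n^nx)^{-1},$$ $$I_0(x)^{n-1}I_1(x)^{n-2}\cdots I_{n-1}(x)^0=(1-n^nx)^{-(n-1)/2},$$ $$I_p(x)=I_{n-1-p}(x)\qquad(0\le p\le n-1).$$
   Context: $\mathcal P\subset 1+x\,\mathbb Q(w)[[x]]$ denotes the multiplicative group of power series in $x$ with constant term $1$ whose coefficients are rational functions of $w$ (over $\mathbb Q$) that are holomorphic (regular) at $w=0$. Thus $F(w,x)\mapsto F(0,x)\in 1+x\mathbb Q[[x]]$ is well defined on $\mathcal P$. The map $\mathbf M:\mathcal P\to\mathcal P$ is defined by $$\mathbf M F(w,x)=\Big\{1+\frac{x}{w}\frac{\partial}{\partial x}\Big\}\frac{F(w,x)}{F(0,x)},$$ and $\mathbf M^p$ is its $p$-fold iterate. For the fixed positive integer $n$, $$\mathcal F(w,x)=\sum_{d=0}^{\infty}x^d\,\frac{\prod_{r=1}^{nd}(nw+r)}{\prod_{r=1}^{d}\big((w+r)^n-w^n\big)}\in\mathcal P .$$ Powers such as $(1-n^nx)^{-(n-1)/2}$ denote the formal binomial power series with constant term $1$. *)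

theory Defs
  imports "HOL-Computational_Algebra.Computational_Algebra"
begin

text \<open>
  The field \<open>\<rat>(w)\<close> is the fraction field \<^typ>\<open>rat poly fract\<close> of \<open>\<rat>[w]\<close>, and the formal
  variable \<open>x\<close> is \<^term>\<open>fps_X\<close>.
\<close>

definition ratfun_w :: "rat poly fract" where
  "ratfun_w = to_fract [:0, 1:]"

definition ratfun_const :: "rat \<Rightarrow> rat poly fract" where
  "ratfun_const c = to_fract [:c:]"

definition regular0 :: "rat poly fract \<Rightarrow> bool" where
  "regular0 q \<longleftrightarrow> (\<exists>a b. poly b 0 \<noteq> 0 \<and> q = Fract a b)"

text \<open>
  The value at \<open>w = 0\<close>. It does not depend on the chosen representation (see \<open>eval0_Fract\<close> below)
  and is meaningful only for \<open>q\<close> regular at \<open>0\<close>.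
\<close>
definition eval0 :: "rat poly fract \<Rightarrow> rat" where
  "eval0 q = (THE c. \<exists>a b. poly b 0 \<noteq> 0 \<and> q = Fract a b \<and> c = poly a 0 / poly b 0)"

definition P_group :: "rat poly fract fps set" where
  "P_group = {F. fps_nth F 0 = 1 \<and> (\<forall>d. regular0 (fps_nth F d))}"

text \<open>\<open>F(w,x) \<mapsto> F(0,x)\<close>, and the inclusion of \<open>\<rat>[[x]]\<close> into \<open>\<rat>(w)[[x]]\<close>.\<close>

definition at_w0 :: "rat poly fract fps \<Rightarrow> rat fps" where
  "at_w0 F = Abs_fps (\<lambda>d. eval0 (fps_nth F d))"

definition emb_w :: "rat fps \<Rightarrow> rat poly fract fps" where
  "emb_w f = Abs_fps (\<lambda>d. ratfun_const (fps_nth f d))"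

definition M_op :: "rat poly fract fps \<Rightarrow> rat poly fract fps" where
  "M_op F = (let G = F / emb_w (at_w0 F)
             in G + fps_const (1 / ratfun_w) * fps_X * fps_deriv G)"

definition F_ser :: "nat \<Rightarrow> rat poly fract fps" where
  "F_ser n = Abs_fps (\<lambda>d.
     (\<Prod>r=1..n*d. of_nat n * ratfun_w + of_nat r) /
     (\<Prod>r=1..d. (ratfun_w + of_nat r) ^ n - ratfun_w ^ n))"

definition I_ser :: "nat \<Rightarrow> nat \<Rightarrow> rat fps" where
  "I_ser n p = at_w0 ((M_op ^^ p) (F_ser n))"

text \<open>The formal binomial series \<open>(1 - c x)\<^sup>a\<close>.\<close>
definition one_minus_pow :: "rat \<Rightarrow> rat \<Rightarrow> rat fps" where
  "one_minus_pow c a = fps_compose (fps_binomial a) (- (fps_const c * fps_X))"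


subsection \<open>Well-definedness\<close>

lemma eval0_Fract:
  assumes "poly b 0 \<noteq> 0"
  shows "eval0 (Fract a b) = poly a 0 / poly b 0"
  unfolding eval0_def
proof (rule the_equality)
  show "\<exists>a' b'. poly b' 0 \<noteq> 0 \<and> Fract a b = Fract a' b' \<and> poly a 0 / poly b 0 = poly a' 0 / poly b' 0"
    using assms by blast
next
  fix c
  assume "\<exists>a' b'. poly b' 0 \<noteq> 0 \<and> Fract a b = Fract a' b' \<and> c = poly a' 0 / poly b' 0"
  then obtain a' b' where *: "poly b' 0 \<noteq> 0" "Fract a b = Fract a' b'" "c = poly a' 0 / poly b' 0"
    by blast
  have "b \<noteq> 0" "b' \<noteq> 0" using assms * by auto
  hence "a * b' = a' * b" using *(2) by (simp add: eq_fract)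
  hence "poly a 0 * poly b' 0 = poly a' 0 * poly b 0" by (metis poly_mult)
  thus "c = poly a 0 / poly b 0" unfolding *(3) using assms *(1) by (simp add: frac_eq_eq)
qed

lemma regular0_Fract: "poly b 0 \<noteq> 0 \<Longrightarrow> regular0 (Fract a b)"
  unfolding regular0_def by blast

lemma regular0_to_fract [simp]: "regular0 (to_fract a)"
  and eval0_to_fract [simp]: "eval0 (to_fract a) = poly a 0"
  by (simp_all add: regular0_Fract to_fract_def eval0_Fract)

lemma eval0_ratfun_const [simp]: "regular0 (ratfun_const c)" "eval0 (ratfun_const c) = c"
  by (simp_all add: ratfun_const_def)

lemma regular0_w [simp]: "regular0 ratfun_w" "eval0 ratfun_w = 0"
  by (simp_all add: ratfun_w_def)

lemma of_nat_eq_to_fract: "(of_nat k :: rat poly fract) = to_fract (of_nat k)"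
  by (induction k) simp_all

lemma regular0_of_nat [simp]: "regular0 (of_nat k)" "eval0 (of_nat k) = of_nat k"
  by (simp_all add: of_nat_eq_to_fract)

lemma regular0_0_1 [simp]: "regular0 0" "eval0 0 = 0" "regular0 1" "eval0 1 = 1"
  using regular0_of_nat[of 0] regular0_of_nat[of 1] by simp_all

lemma regular0_add:
  assumes "regular0 p" "regular0 q"
  shows "regular0 (p + q) \<and> eval0 (p + q) = eval0 p + eval0 q"
proof -
  obtain a b c d where *: "poly b 0 \<noteq> 0" "p = Fract a b" "poly d 0 \<noteq> 0" "q = Fract c d"
    using assms unfolding regular0_def by blast
  hence "b \<noteq> 0" "d \<noteq> 0" by auto
  hence "p + q = Fract (a * d + c * b) (b * d)" using * by simp
  moreover have bd: "poly (b * d) 0 \<noteq> 0" using * by simp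
  moreover have "eval0 (Fract (a * d + c * b) (b * d)) = eval0 p + eval0 q"
    using * eval0_Fract[OF bd] by (simp add: eval0_Fract add_frac_eq del: add_fract)
  ultimately show ?thesis using regular0_Fract by metis
qed

lemma regular0_mult:
  assumes "regular0 p" "regular0 q"
  shows "regular0 (p * q) \<and> eval0 (p * q) = eval0 p * eval0 q"
proof -
  obtain a b c d where *: "poly b 0 \<noteq> 0" "p = Fract a b" "poly d 0 \<noteq> 0" "q = Fract c d"
    using assms unfolding regular0_def by blast
  have "p * q = Fract (a * c) (b * d)" using * by simp
  moreover have bd: "poly (b * d) 0 \<noteq> 0" using * by simp
  moreover have "eval0 (Fract (a * c) (b * d)) = eval0 p * eval0 q"
    using * eval0_Fract[OF bd] by (simp add: eval0_Fract del: mult_fract)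
  ultimately show ?thesis using regular0_Fract by metis
qed

lemma regular0_uminus:
  assumes "regular0 p"
  shows "regular0 (- p) \<and> eval0 (- p) = - eval0 p"
proof -
  have "regular0 (to_fract [:-1:] * p) \<and> eval0 (to_fract [:-1:] * p) = - eval0 p"
    using regular0_mult[OF regular0_to_fract assms, of "[:-1:]"] by simp
  moreover have "[:-1::rat:] = -1" by (simp add: one_pCons)
  hence "to_fract [:-1:] * p = - p"
    by (simp add: to_fract_uminus)
  ultimately show ?thesis by simp
qed

lemma regular0_diff:
  assumes "regular0 p" "regular0 q"
  shows "regular0 (p - q) \<and> eval0 (p - q) = eval0 p - eval0 q"
  using regular0_add[of p "- q"] regular0_uminus[of q] assms by simp

lemma regular0_inverse:
  assumes "regular0 p" "eval0 p \<noteq> 0"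
  shows "regular0 (inverse p) \<and> eval0 (inverse p) = inverse (eval0 p)"
proof -
  obtain a b where *: "poly b 0 \<noteq> 0" "p = Fract a b"
    using assms unfolding regular0_def by blast
  have "poly a 0 \<noteq> 0" using assms * by (auto simp: eval0_Fract)
  moreover have "inverse p = Fract b a" using * by simp
  ultimately show ?thesis using * eval0_Fract[of a b] unfolding regular0_def
    by (auto simp: eval0_Fract)
qed

lemma regular0_div_w:
  assumes "regular0 p" "eval0 p = 0"
  shows "regular0 (p / ratfun_w)"
proof -
  obtain a b where *: "poly b 0 \<noteq> 0" "p = Fract a b"
    using assms unfolding regular0_def by blast
  have "poly a 0 = 0" using assms * by (auto simp: eval0_Fract)
  then obtain c where c: "a = [:0, 1:] * c"
    using poly_eq_0_iff_dvd[of a 0] by (auto elim: dvdE)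
  have "b \<noteq> 0" using * by auto
  hence "p / ratfun_w = Fract c b"
    using * c by (simp add: ratfun_w_def to_fract_def eq_fract)
  thus ?thesis using * unfolding regular0_def by auto
qed

lemma regular0_sum:
  assumes "\<And>i. i \<in> A \<Longrightarrow> regular0 (f i)"
  shows "regular0 (sum f A) \<and> eval0 (sum f A) = (\<Sum>i\<in>A. eval0 (f i))"
  using assms by (induction A rule: infinite_finite_induct) (auto simp: regular0_add)

lemma regular0_prod:
  assumes "\<And>i. i \<in> A \<Longrightarrow> regular0 (f i)"
  shows "regular0 (prod f A) \<and> eval0 (prod f A) = (\<Prod>i\<in>A. eval0 (f i))"
  using assms by (induction A rule: infinite_finite_induct) (auto simp: regular0_mult)

lemma regular0_power:
  assumes "regular0 p"
  shows "regular0 (p ^ k) \<and> eval0 (p ^ k) = eval0 p ^ k"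
  using assms by (induction k) (auto simp: regular0_mult)

lemma regular0_fps_mult:
  assumes "\<And>d. regular0 (fps_nth F d)" "\<And>d. regular0 (fps_nth G d)"
  shows "regular0 (fps_nth (F * G) d)" and "at_w0 (F * G) = at_w0 F * at_w0 G"
proof -
  have *: "regular0 (fps_nth (F * G) d) \<and>
        eval0 (fps_nth (F * G) d) = fps_nth (at_w0 F * at_w0 G) d" for d
    unfolding fps_mult_nth at_w0_def
    using regular0_sum[of "{0..d}" "\<lambda>i. fps_nth F i * fps_nth G (d - i)"] assms
    by (simp add: regular0_mult)
  show "regular0 (fps_nth (F * G) d)" using * by simp
  show "at_w0 (F * G) = at_w0 F * at_w0 G" 
    by (rule fps_ext, subst at_w0_def) (simp add: *)
qed

lemma ratfun_const_sum: "ratfun_const (sum f A) = (\<Sum>i\<in>A. ratfun_const (f i))"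
proof -
  have "ratfun_const (a + b) = ratfun_const a + ratfun_const b" for a b
    by (simp add: ratfun_const_def flip: to_fract_add)
  moreover have "ratfun_const 0 = 0" by (simp add: ratfun_const_def)
  ultimately show ?thesis by (induction A rule: infinite_finite_induct) simp_all
qed

lemma ratfun_const_mult: "ratfun_const (a * b) = ratfun_const a * ratfun_const b"
  by (simp add: ratfun_const_def flip: to_fract_mult)

lemma emb_w_mult: "emb_w (f * g) = emb_w f * emb_w g"
  by (rule fps_ext) (simp add: emb_w_def fps_mult_nth ratfun_const_sum ratfun_const_mult)

lemma ratfun_const_0_1 [simp]: "ratfun_const 0 = 0" "ratfun_const 1 = 1"
  by (simp_all add: ratfun_const_def flip: one_pCons)

lemma emb_w_1 [simp]: "emb_w 1 = 1"
  by (rule fps_ext) (simp add: emb_w_def)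

lemma at_w0_emb_w [simp]: "at_w0 (emb_w f) = f"
  by (rule fps_ext) (simp add: at_w0_def emb_w_def)

lemma at_w0_nth_0: "F \<in> P_group \<Longrightarrow> fps_nth (at_w0 F) 0 = 1"
  by (simp add: P_group_def at_w0_def)

lemma M_op_in_P_group:
  assumes "F \<in> P_group"
  shows "M_op F \<in> P_group"
proof -
  define f where "f = at_w0 F"
  define G where "G = F / emb_w f"
  have f0: "fps_nth f 0 = 1" using assms by (simp add: f_def at_w0_nth_0)
  have e0: "fps_nth (emb_w f) 0 = 1" by (simp add: emb_w_def f0)
  have "f * inverse f = 1" using f0 by (simp add: inverse_mult_eq_1')
  hence inv: "emb_w f * emb_w (inverse f) = 1" by (simp flip: emb_w_mult)
  hence "G = F * emb_w (inverse f)"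
    using e0 by (simp add: G_def fps_divide_unit fps_inverse_unique)
  moreover have "regular0 (fps_nth (emb_w (inverse f)) d)" for d by (simp add: emb_w_def)
  moreover have "regular0 (fps_nth F d)" for d using assms by (simp add: P_group_def)
  ultimately have reg: "regular0 (fps_nth G d)" and at: "at_w0 G = 1" for d
    using regular0_fps_mult[of F "emb_w (inverse f)"] \<open>f * inverse f = 1\<close>
    by (simp_all add: f_def)
  have G0: "fps_nth G 0 = 1"
    using assms e0 by (simp add: G_def fps_divide_unit P_group_def)
  have M: "M_op F = G + fps_const (1 / ratfun_w) * fps_X * fps_deriv G"
    unfolding M_op_def Let_def G_def f_def ..
  have Md: "fps_nth (M_op F) d = fps_nth G d + of_nat d * (fps_nth G d / ratfun_w)" for d
    by (cases d) (simp_all add: M mult.assoc)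
  have "regular0 (fps_nth (M_op F) d)" for d
  proof (cases "d = 0")
    case True
    thus ?thesis using Md[of d] G0 by simp
  next
    case False
    have "eval0 (fps_nth G d) = 0"
      using arg_cong[OF at, of "\<lambda>h. fps_nth h d"] False by (simp add: at_w0_def)
    thus ?thesis using reg[of d]
      by (simp add: Md regular0_add regular0_mult regular0_div_w)
  qed
  thus ?thesis using Md[of 0] G0 by (simp add: P_group_def)
qed

lemma F_ser_in_P_group:
  assumes "n > 0"
  shows "F_ser n \<in> P_group"
proof -
  have num: "regular0 (\<Prod>r=1..n*d. of_nat n * ratfun_w + of_nat r)" for d
    by (intro conjunct1[OF regular0_prod]) (simp add: regular0_add regular0_mult)
  have fac: "regular0 ((ratfun_w + of_nat r) ^ n - ratfun_w ^ n) \<and>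
      eval0 ((ratfun_w + of_nat r) ^ n - ratfun_w ^ n) = of_nat r ^ n" for r
    using assms by (simp add: regular0_add regular0_diff regular0_power)
  have den: "regular0 (\<Prod>r=1..d. (ratfun_w + of_nat r) ^ n - ratfun_w ^ n) \<and>
      eval0 (\<Prod>r=1..d. (ratfun_w + of_nat r) ^ n - ratfun_w ^ n) = (\<Prod>r=1..d. of_nat r ^ n)" for d
    using regular0_prod[of "{1..d}" "\<lambda>r. (ratfun_w + of_nat r) ^ n - ratfun_w ^ n"] fac by simp
  have "(\<Prod>r=1..d. of_nat r ^ n) \<noteq> (0::rat)" for d by simp
  thus ?thesis
    unfolding P_group_def F_ser_def
    using num den by (simp add: divide_inverse regular0_mult regular0_inverse)
qed

lemma I_ser_nth_0:
  assumes "n > 0"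
  shows "fps_nth (I_ser n p) 0 = 1"
proof -
  have "(M_op ^^ p) (F_ser n) \<in> P_group"
    by (induction p) (simp_all add: F_ser_in_P_group assms M_op_in_P_group)
  thus ?thesis by (simp add: I_ser_def at_w0_nth_0)
qed

end

theory Submission
  imports Defs
begin

text \<open>
  Put \<open>D = w + x d/dx\<close>, so that \<open>w\<^sup>n M\<^sup>n\<close> is the operator \<open>D I\<^sub>n\<^sub>-\<^sub>1\<^sup>-\<^sup>1 D \<dots> D I\<^sub>0\<^sup>-\<^sup>1\<close>, while
  the hypergeometric equation reads \<open>L F = w\<^sup>n F\<close> with \<open>L = D\<^sup>n - x (nD + 1) \<dots> (nD + n)\<close>.
  Let \<open>h = (1 - n\<^sup>n x) I\<^sub>0 \<dots> I\<^sub>n\<^sub>-\<^sub>1\<close>. Then \<open>h w\<^sup>n M\<^sup>n - L\<close> has order less than \<open>n\<close> in \<open>D\<close> but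
  sends \<open>F\<close> to a series divisible by \<open>w\<^sup>n\<close>, which forces it to vanish. Since \<open>L\<close> is divisible by
  \<open>D\<close> on the left, \<open>h = 1\<close>, and cancelling \<open>D\<close> gives
  \<open>I\<^sub>n\<^sub>-\<^sub>1\<^sup>-\<^sup>1 D \<dots> D I\<^sub>0\<^sup>-\<^sup>1 = D\<^sup>n\<^sup>-\<^sup>1 - n x (nD + 1) \<dots> (nD + n - 1)\<close>.
  The right-hand side is self-adjoint up to sign and such factorizations are unique, hence
  \<open>I\<^sub>p = I\<^sub>n\<^sub>-\<^sub>1\<^sub>-\<^sub>p\<close>. The second product formula is the square root of a power of the first, by this symmetry.
\<close>

section \<open>Symbols of differential operators\<close>

text \<open>
  An operator \<open>P = \<Sum> x\<^sup>m a\<^sub>m(D)\<close> is represented by its symbol \<open>P 1 = \<Sum> x\<^sup>m a\<^sub>m(w)\<close>. Composing on the left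
  with \<open>D\<close> or with a series \<open>f(x)\<close> acts on symbols as \<open>theta_w\<close> or as multiplication by \<open>fps_lift f\<close>;
  composing on the right with \<open>D\<close> multiplies the symbol by \<open>w\<close>, and with \<open>f(x)\<close> is \<open>right_mult f\<close>.
  The shifts \<open>w + j\<close> below come from \<open>D x\<^sup>j = x\<^sup>j (D + j)\<close>.
\<close>

definition fps_lift :: "rat fps \<Rightarrow> rat poly fps" where
  "fps_lift f = Abs_fps (\<lambda>m. [:fps_nth f m:])"

definition theta_w :: "rat poly fps \<Rightarrow> rat poly fps" where
  "theta_w G = fps_const [:0, 1:] * G + fps_X * fps_deriv G"

definition right_mult :: "rat fps \<Rightarrow> rat poly fps \<Rightarrow> rat poly fps" where
  "right_mult f G = Abs_fps (\<lambda>m. \<Sum>j=0..m. smult (fps_nth f j) (pcompose (fps_nth G (m - j)) [:of_nat j, 1:]))"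

text \<open>The formal adjoint, determined by \<open>D \<mapsto> -D\<close> and \<open>x \<mapsto> x\<close>.\<close>
definition adjoint_op :: "rat poly fps \<Rightarrow> rat poly fps" where
  "adjoint_op G = Abs_fps (\<lambda>m. pcompose (fps_nth G m) [:- of_nat m, -1:])"

text \<open>The operator with symbol \<open>G\<close> acting on \<open>F\<close>: since D x^j = (w +
  j) x^j, a polynomial a(D) multiplies the x^j term by a(w + j).\<close>

definition op_apply :: "rat poly fps \<Rightarrow> rat poly fract fps \<Rightarrow> rat poly fract fps" where
  "op_apply G F = Abs_fps (\<lambda>m. \<Sum>j=0..m. fps_nth F j * to_fract (pcompose (fps_nth G (m - j)) [:of_nat j, 1:]))"

text \<open>Symbol of f_1 D f_2 D ... D f_k; the singleton case keeps a D from following the last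
  series.\<close>

fun op_chain :: "rat fps list \<Rightarrow> rat poly fps" where
  "op_chain [] = 1"
| "op_chain [f] = fps_lift f"
| "op_chain (f # g # fs) = fps_lift f * theta_w (op_chain (g # fs))"

lemma fps_lift_nth [simp]: "fps_nth (fps_lift f) m = [:fps_nth f m:]"
  by (simp add: fps_lift_def)

lemma sum_pCons_const: "(\<Sum>i\<in>A. [:f i:]) = [:\<Sum>i\<in>A. f i:]"
  by (induction A rule: infinite_finite_induct) auto

lemma smult_sum_right: "smult a (\<Sum>i\<in>A. f i) = (\<Sum>i\<in>A. smult a (f i))"
  by (induction A rule: infinite_finite_induct) (auto simp: smult_add_right)

lemma fps_lift_mult: "fps_lift (f * g) = fps_lift f * fps_lift g"
  by (rule fps_ext) (simp add: fps_mult_nth mult.commute flip: sum_pCons_const)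

lemma fps_lift_1 [simp]: "fps_lift 1 = 1"
  by (rule fps_ext) simp

lemma fps_lift_inverse:
  assumes "fps_nth f 0 \<noteq> 0"
  shows "fps_lift (inverse f) * fps_lift f = 1"
  using assms by (simp add: inverse_mult_eq_1 flip: fps_lift_mult)

lemma fps_lift_mult_nth: "fps_nth (fps_lift f * G) m = (\<Sum>j=0..m. smult (fps_nth f j) (fps_nth G (m - j)))"
  by (simp add: fps_mult_nth)

lemma theta_w_nth: "fps_nth (theta_w G) m = [:of_nat m, 1:] * fps_nth G m"
proof (cases m)
  case (Suc k)
  have "(of_nat m :: rat poly) = [:of_nat m:]"
    by (simp add: of_nat_poly)
  thus ?thesis using Suc
    by (simp add: theta_w_def algebra_simps flip: of_nat_Suc)
qed (simp add: theta_w_def)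

lemma right_mult_nth:
  "fps_nth (right_mult f G) m = (\<Sum>j=0..m. smult (fps_nth f j) (pcompose (fps_nth G (m - j)) [:of_nat j, 1:]))"
  by (simp add: right_mult_def)

lemma adjoint_op_nth: "fps_nth (adjoint_op G) m = pcompose (fps_nth G m) [:- of_nat m, -1:]"
  by (simp add: adjoint_op_def)

lemma pcompose_shift_shift: "pcompose (pcompose p [:a, 1:]) [:b, 1:] = pcompose p [:a + b, 1::rat:]"
  by (simp add: pcompose_pCons add.commute flip: pcompose_assoc)

lemma pcompose_power: "pcompose (p ^ k) q = pcompose p q ^ k"
  for p q :: "rat poly"
  by (induction k) (simp_all add: pcompose_mult pcompose_1)

text \<open>Associativity (f G) g = f (G g): both coefficients are the same double sum over
  \<open>i + j \<le> m\<close>.\<close>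

lemma right_mult_lift_mult: "right_mult g (fps_lift f * G) = fps_lift f * right_mult g G"
proof (rule fps_ext)
  fix m
  define t where "t i j = smult (fps_nth f i * fps_nth g j) (pcompose (fps_nth G (m - i - j)) [:of_nat j, 1:])" for i j
  have "fps_nth (right_mult g (fps_lift f * G)) m = (\<Sum>j=0..m. \<Sum>i=0..m-j. t i j)"
    unfolding right_mult_nth fps_lift_mult_nth pcompose_sum smult_sum_right t_def
    by (intro sum.cong refl) (simp add: pcompose_smult mult.commute add.commute)
  also have "\<dots> = (\<Sum>i=0..m. \<Sum>j=0..m-i. t i j)"
    unfolding sum.Sigma[OF finite_atLeastAtMost ballI[OF finite_atLeastAtMost]]
    by (rule sum.reindex_bij_witness[of _ "\<lambda>(a,b). (b,a)" "\<lambda>(a,b). (b,a)"]) auto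
  also have "\<dots> = fps_nth (fps_lift f * right_mult g G) m"
    unfolding right_mult_nth fps_lift_mult_nth smult_sum_right t_def
    by (intro sum.cong refl) simp
  finally show "fps_nth (right_mult g (fps_lift f * G)) m = fps_nth (fps_lift f * right_mult g G) m" .
qed

text \<open>Associativity (D G) g = D (G g): the shift by \<open>j\<close> turns w + (m - j) into w
  + m, which leaves the sum.\<close>

lemma right_mult_theta_w: "right_mult g (theta_w G) = theta_w (right_mult g G)"
proof (rule fps_ext)
  fix m
  have "pcompose ([:of_nat (m - j), 1:] * p) [:of_nat j, 1:] = [:of_nat m, 1:] * pcompose p [:of_nat j, 1:]"
    if "j \<le> m" for j and p :: "rat poly"
    using that by (simp add: pcompose_mult pcompose_pCons of_nat_diff del: mult_pCons_left)
  thus "fps_nth (right_mult g (theta_w G)) m = fps_nth (theta_w (right_mult g G)) m"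
    unfolding right_mult_nth theta_w_nth sum_distrib_left
    by (intro sum.cong refl) (metis atLeastAtMost_iff mult_smult_right)
qed

lemma right_mult_1: "right_mult g 1 = fps_lift g"
proof (rule fps_ext)
  fix m
  have "fps_nth (right_mult g 1) m = (\<Sum>j=0..m. if j = m then [:fps_nth g j:] else 0)"
    unfolding right_mult_nth by (intro sum.cong refl) (auto simp: pcompose_1)
  thus "fps_nth (right_mult g 1) m = fps_nth (fps_lift g) m" by simp
qed

lemma theta_w_const_mult: "theta_w (fps_const [:0, 1:] * G) = fps_const [:0, 1:] * theta_w G"
  by (simp add: theta_w_def algebra_simps)

lemma theta_w_1: "theta_w 1 = fps_const [:0, 1:]"
  by (simp add: theta_w_def)

text \<open>Chains unfold from the left, but the adjoint makes them grow on the right. Appending D g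
  multiplies the symbol by w, then applies \<open>right_mult g\<close>.\<close>

lemma op_chain_snoc:
  assumes "fs \<noteq> []"
  shows "op_chain (fs @ [g]) = right_mult g (fps_const [:0, 1:] * op_chain fs)"
  using assms
proof (induction fs rule: op_chain.induct)
  case (2 f)
  have "op_chain ([f] @ [g]) = fps_lift f * theta_w (right_mult g 1)"
    by (simp add: right_mult_1)
  also have "\<dots> = right_mult g (fps_lift f * theta_w 1)"
    by (simp add: right_mult_lift_mult right_mult_theta_w)
  finally show ?case by (simp add: theta_w_1 mult.commute)
next
  case (3 f f' fs)
  have "op_chain ((f # f' # fs) @ [g]) = right_mult g (fps_lift f * theta_w (fps_const [:0, 1:] * op_chain (f' # fs)))"
    using 3 by (simp add: right_mult_lift_mult right_mult_theta_w)
  thus ?case by (simp add: theta_w_const_mult mult.left_commute)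
qed simp

section \<open>The formal adjoint\<close>

text \<open>The adjoint reverses composition: replacing w by -w - (m - j) and then w by w + j
  amounts to replacing w by -w - m.\<close>

lemma adjoint_op_lift_mult: "adjoint_op (fps_lift f * G) = right_mult f (adjoint_op G)"
proof (rule fps_ext)
  fix m
  have "pcompose p [:- of_nat m, -1:] = pcompose (pcompose p [:- of_nat (m - j), -1:]) [:of_nat j, 1:]"
    if "j \<le> m" for j and p :: "rat poly"
    using that by (simp add: pcompose_pCons of_nat_diff flip: pcompose_assoc)
  thus "fps_nth (adjoint_op (fps_lift f * G)) m = fps_nth (right_mult f (adjoint_op G)) m"
    unfolding adjoint_op_nth right_mult_nth fps_lift_mult_nth pcompose_sum pcompose_smult
    by (intro sum.cong refl) (metis atLeastAtMost_iff)
qed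

text \<open>The left factor w + m becomes -w, that is, -D composed on the right.\<close>

lemma adjoint_op_theta_w: "adjoint_op (theta_w G) = - (fps_const [:0, 1:] * adjoint_op G)"
proof -
  have "[:0, -1::rat:] = - [:0, 1:]" by simp
  thus ?thesis
    by (intro fps_ext) (simp add: adjoint_op_nth theta_w_nth pcompose_mult pcompose_pCons del: mult_pCons_left minus_pCons)
qed

lemma right_mult_uminus: "right_mult f (- G) = - right_mult f G"
  by (rule fps_ext) (simp add: right_mult_nth pcompose_uminus sum_negf)

lemma right_mult_const_mult: "right_mult f (fps_const [:c:] * G) = fps_const [:c:] * right_mult f G"
  by (rule fps_ext) (simp add: right_mult_nth pcompose_smult smult_sum_right mult.commute)

lemma adjoint_op_lift: "adjoint_op (fps_lift f) = fps_lift f"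
  by (rule fps_ext) (simp add: adjoint_op_nth)

text \<open>The factors are reversed, and each of the \<open>length fs\<close> copies of D
  contributes a sign.\<close>

lemma adjoint_op_chain:
  "adjoint_op (op_chain (f # fs)) = fps_const [:(- 1) ^ length fs:] * op_chain (rev (f # fs))"
proof (induction fs arbitrary: f)
  case Nil
  show ?case by (simp add: adjoint_op_lift flip: one_pCons)
next
  case (Cons g fs)
  have "adjoint_op (op_chain (f # g # fs)) = right_mult f (- (fps_const [:0, 1:] * adjoint_op (op_chain (g # fs))))"
    by (simp add: adjoint_op_lift_mult adjoint_op_theta_w)
  also have "\<dots> = - right_mult f (fps_const [:(- 1) ^ length fs:] * (fps_const [:0, 1:] * op_chain (rev (g # fs))))"
    by (simp only: right_mult_uminus Cons mult.left_commute)
  also have "\<dots> = - (fps_const [:(- 1) ^ length fs:] * op_chain (rev (g # fs) @ [f]))"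
    by (subst right_mult_const_mult, subst op_chain_snoc) auto
  also have "\<dots> = fps_const [:(- 1) ^ length (g # fs):] * op_chain (rev (f # g # fs))"
    by (rule fps_ext) simp
  finally show ?case .
qed

section \<open>Uniqueness of factorizations\<close>

lemma theta_w_inject:
  assumes "theta_w G = theta_w H"
  shows "G = H"
proof (rule fps_ext)
  fix m
  have "[:of_nat m, 1:] * fps_nth G m = [:of_nat m, 1:] * fps_nth H m"
    using arg_cong[OF assms, of "\<lambda>F. fps_nth F m"] by (simp only: theta_w_nth)
  thus "fps_nth G m = fps_nth H m" by (subst (asm) mult_left_cancel) auto
qed

text \<open>Serves twice: to obtain h = 1 and D-free operators from the hypergeometric equation, and
  to peel chains factor by factor.\<close>

lemma theta_w_left_factor_unique:
  assumes eq: "theta_w H = fps_lift u * theta_w G"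
    and u0: "fps_nth u 0 = 1" and G0: "fps_nth G 0 = [:0, 1:] ^ k"
  shows "u = 1" and "H = G"
proof -
  \<comment> \<open>The coefficient of \<open>x\<^sup>m\<close> in \<open>theta_w H\<close> has the factor \<open>w + m\<close>, so it vanishes at \<open>w = -m\<close>.\<close>
  have u: "fps_nth u m = 0" if "m > 0" for m
    using that
  proof (induction m rule: less_induct)
    case (less m)
    have "0 = poly (fps_nth (theta_w H) m) (- of_nat m)"
      by (simp add: theta_w_nth)
    also have "\<dots> = (\<Sum>j=0..m. fps_nth u j * (- of_nat j * poly (fps_nth G (m - j)) (- of_nat m)))"
      unfolding eq fps_lift_mult_nth poly_sum
      by (intro sum.cong refl) (simp add: theta_w_nth of_nat_diff algebra_simps)
    \<comment> \<open>The term j = 0 vanishes through its factor j, those with 0 < j < m by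
      induction. The remaining one forces u_m = 0, since w^k is nonzero at w = -m.\<close>
    also have "\<dots> = (\<Sum>j=0..m. if j = m then fps_nth u m * (- of_nat m * poly (fps_nth G 0) (- of_nat m)) else 0)"
    proof (intro sum.cong refl)
      fix j assume "j \<in> {0..m}"
      then consider "j = 0" | "j = m" | "0 < j" "j < m" by fastforce
      thus "fps_nth u j * (- of_nat j * poly (fps_nth G (m - j)) (- of_nat m))
          = (if j = m then fps_nth u m * (- of_nat m * poly (fps_nth G 0) (- of_nat m)) else 0)"
        by cases (use less in auto)
    qed
    also have "\<dots> = fps_nth u m * (- of_nat m * (- of_nat m) ^ k)"
      by (simp add: G0 poly_power)
    finally show ?case using less by simp
  qed
  show "u = 1"
  proof (rule fps_ext)
    show "fps_nth u m = fps_nth 1 m" for m using u[of m] u0 by (cases "m = 0") simp_all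
  qed
  thus "H = G" using eq theta_w_inject by simp
qed

lemma op_chain_nth_0:
  assumes "\<forall>g\<in>set (f # fs). fps_nth g 0 = 1"
  shows "fps_nth (op_chain (f # fs)) 0 = [:0, 1:] ^ length fs"
  using assms
proof (induction fs arbitrary: f)
  case (Cons g fs)
  thus ?case by (simp add: theta_w_nth flip: one_pCons)
qed (simp flip: one_pCons)

text \<open>Dividing by the leading series of one chain leaves two operators with D on the left, so
  the leading series agree and D cancels.\<close>

lemma op_chain_inject:
  assumes "op_chain fs = op_chain gs" "length fs = length gs"
    and "\<forall>f\<in>set fs. fps_nth f 0 = 1" "\<forall>g\<in>set gs. fps_nth g 0 = 1"
  shows "fs = gs"
  using assms(2,1,3,4)
proof (induction fs gs rule: list_induct2)
  case (Cons f fs g gs)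
  show ?case
  proof (cases fs)
    case Nil
    hence "fps_lift f = fps_lift g" "gs = []" using Cons by auto
    moreover from this have "f = g" by (simp add: fps_lift_def fps_eq_iff)
    ultimately show ?thesis using Nil by simp
  next
    case fs: (Cons f' fs')
    then obtain g' gs' where gs: "gs = g' # gs'" using Cons.hyps by (cases gs) auto
    have one: "fps_nth f 0 = 1" "fps_nth g 0 = 1" using Cons.prems by auto
    have eq: "fps_lift f * theta_w (op_chain fs) = fps_lift g * theta_w (op_chain gs)"
      using Cons.prems fs gs by simp
    have "theta_w (op_chain gs) = fps_lift (inverse g) * (fps_lift g * theta_w (op_chain gs))"
      using one by (simp add: fps_lift_inverse flip: mult.assoc)
    also have "\<dots> = fps_lift (inverse g * f) * theta_w (op_chain fs)"
      by (simp add: fps_lift_mult mult.assoc flip: eq)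
    finally have *: "theta_w (op_chain gs) = fps_lift (inverse g * f) * theta_w (op_chain fs)" .
    have G0: "fps_nth (op_chain fs) 0 = [:0, 1:] ^ length fs'"
      unfolding fs by (rule op_chain_nth_0) (use Cons.prems fs in auto)
    have u0: "fps_nth (inverse g * f) 0 = 1" using one by simp
    have "inverse g * f = 1" "op_chain gs = op_chain fs"
      using theta_w_left_factor_unique[OF * u0 G0] by auto
    hence "f = g" "fs = gs"
      using Cons.IH Cons.prems one
      by (auto, metis inverse_mult_eq_1' mult.assoc mult.left_neutral mult.right_neutral zero_neq_one)
    thus ?thesis by simp
  qed
qed simp


section \<open>Action of operators on series over Q(w)\<close>

lemma to_fract_sum: "to_fract (sum f A) = (\<Sum>i\<in>A. to_fract (f i))"
  by (induction A rule: infinite_finite_induct) auto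

lemma to_fract_power: "to_fract (p ^ k) = to_fract p ^ k"
  by (induction k) auto

lemma to_fract_prod: "to_fract (prod f A) = (\<Prod>i\<in>A. to_fract (f i))"
  by (induction A rule: infinite_finite_induct) auto

lemma emb_w_nth: "fps_nth (emb_w f) m = to_fract [:fps_nth f m:]"
  by (simp add: emb_w_def ratfun_const_def)

lemma to_fract_smult: "to_fract (smult a p) = to_fract [:a:] * to_fract p"
  by (simp flip: to_fract_mult)

lemma to_fract_linear: "to_fract [:of_nat a, of_nat b:] = of_nat b * ratfun_w + of_nat a"
  by (simp add: ratfun_w_def of_nat_eq_to_fract of_nat_poly flip: to_fract_mult to_fract_add)

lemma op_apply_nth:
  "fps_nth (op_apply G F) m = (\<Sum>j=0..m. fps_nth F j * to_fract (pcompose (fps_nth G (m - j)) [:of_nat j, 1:]))"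
  by (simp add: op_apply_def)

lemma op_apply_lift_mult: "op_apply (fps_lift f * G) F = emb_w f * op_apply G F"
proof (rule fps_ext)
  fix m
  define t where "t i j = to_fract [:fps_nth f i:] * (fps_nth F j * to_fract (pcompose (fps_nth G (m - i - j)) [:of_nat j, 1:]))" for i j
  have "fps_nth (op_apply (fps_lift f * G) F) m = (\<Sum>j=0..m. \<Sum>i=0..m-j. t i j)"
    unfolding op_apply_nth fps_lift_mult_nth pcompose_sum to_fract_sum sum_distrib_left t_def
    by (intro sum.cong refl) (simp add: pcompose_smult to_fract_smult add.commute mult.left_commute)
  also have "\<dots> = (\<Sum>i=0..m. \<Sum>j=0..m-i. t i j)"
    unfolding sum.Sigma[OF finite_atLeastAtMost ballI[OF finite_atLeastAtMost]]
    by (rule sum.reindex_bij_witness[of _ "\<lambda>(a,b). (b,a)" "\<lambda>(a,b). (b,a)"]) auto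
  also have "\<dots> = fps_nth (emb_w f * op_apply G F) m"
    unfolding fps_mult_nth op_apply_nth emb_w_nth sum_distrib_left t_def
    by (intro sum.cong refl)
  finally show "fps_nth (op_apply (fps_lift f * G) F) m = fps_nth (emb_w f * op_apply G F) m" .
qed

definition theta_ratfun :: "rat poly fract fps \<Rightarrow> rat poly fract fps" where
  "theta_ratfun H = fps_const ratfun_w * H + fps_X * fps_deriv H"

lemma theta_ratfun_nth: "fps_nth (theta_ratfun H) m = (ratfun_w + of_nat m) * fps_nth H m"
  by (cases m) (simp_all add: theta_ratfun_def algebra_simps)

lemma theta_ratfun_const_mult: "theta_ratfun (fps_const c * H) = fps_const c * theta_ratfun H"
  by (rule fps_ext) (simp add: theta_ratfun_nth)

lemma op_apply_theta_w: "op_apply (theta_w G) F = theta_ratfun (op_apply G F)"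
proof (rule fps_ext)
  fix m
  have "to_fract (pcompose ([:of_nat (m - j), 1:] * p) [:of_nat j, 1:])
      = (ratfun_w + of_nat m) * to_fract (pcompose p [:of_nat j, 1:])"
    if "j \<le> m" for j and p :: "rat poly"
  proof -
    have "pcompose ([:of_nat (m - j), 1:] * p) [:of_nat j, 1:] = [:of_nat m, of_nat 1:] * pcompose p [:of_nat j, 1:]"
      using that by (simp add: pcompose_mult pcompose_pCons of_nat_diff del: mult_pCons_left)
    thus ?thesis by (simp only: to_fract_mult to_fract_linear) simp
  qed
  thus "fps_nth (op_apply (theta_w G) F) m = fps_nth (theta_ratfun (op_apply G F)) m"
    unfolding op_apply_nth theta_w_nth theta_ratfun_nth sum_distrib_left
    by (intro sum.cong refl) (metis atLeastAtMost_iff mult.left_commute)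
qed

lemma op_apply_1: "op_apply 1 F = F"
proof (rule fps_ext)
  fix m
  have "fps_nth (op_apply 1 F) m = (\<Sum>j=0..m. if j = m then fps_nth F j else 0)"
    unfolding op_apply_nth by (intro sum.cong refl) (auto simp: pcompose_1)
  thus "fps_nth (op_apply 1 F) m = fps_nth F m" by simp
qed

lemma op_apply_diff: "op_apply (G - H) F = op_apply G F - op_apply H F"
  by (rule fps_ext) (simp add: op_apply_nth pcompose_diff right_diff_distrib sum_subtractf)

section \<open>Vanishing of operators of low order\<close>

text \<open>Writing q = a/b with b(0) nonzero, w^n divides g b and hence g, which is impossible for
  nonzero \<open>g\<close> of smaller degree.\<close>

lemma w_power_dvd_imp_zero:
  assumes eq: "to_fract g = ratfun_w ^ n * q" and q: "regular0 q" and deg: "degree g < n"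
  shows "g = 0"
proof (rule ccontr)
  assume g: "g \<noteq> 0"
  obtain a b where ab: "poly b 0 \<noteq> 0" "q = Fract a b"
    using q unfolding regular0_def by blast
  have b: "b \<noteq> 0" using ab by auto
  have "ratfun_w ^ n = to_fract ([:0, 1:] ^ n)"
    by (simp add: ratfun_w_def to_fract_power)
  hence "Fract g 1 = Fract ([:0, 1:] ^ n * a) b"
    using eq ab b by (simp add: to_fract_def)
  hence "g * b = [:0, 1:] ^ n * a"
    using b by (simp add: eq_fract)
  hence "[:- 0, 1:] ^ n dvd g * b" by simp
  hence "n \<le> order 0 (g * b)"
    using g b by (subst (asm) order_divides) auto
  also have "order 0 (g * b) = order 0 g"
    using g b ab by (simp add: order_mult order_0I)
  also have "\<dots> \<le> degree g" using g by (rule order_degree)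
  finally show False using deg by simp
qed

text \<open>If all lower coefficients of \<open>G\<close> vanish, the x^m coefficient of the result
  is that of \<open>G\<close> itself, because \<open>F\<close> has constant term 1.\<close>

lemma op_apply_eq_O_imp_zero:
  assumes F0: "fps_nth F 0 = 1"
    and reg: "\<And>m. \<exists>q. regular0 q \<and> fps_nth (op_apply G F) m = ratfun_w ^ n * q"
    and deg: "\<And>m. degree (fps_nth G m) < n"
  shows "G = 0"
proof (rule fps_ext)
  fix m
  show "fps_nth G m = fps_nth 0 m"
  proof (induction m rule: less_induct)
    case (less m)
    have "fps_nth (op_apply G F) m = (\<Sum>j=0..m. if j = 0 then to_fract (fps_nth G m) else 0)"
      unfolding op_apply_nth using less by (intro sum.cong refl) (auto simp: F0)
    hence "to_fract (fps_nth G m) = fps_nth (op_apply G F) m" by simp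
    thus ?case using reg[of m] deg[of m] w_power_dvd_imp_zero by auto
  qed
qed

section \<open>Iterates of M as operators\<close>

text \<open>The factor w clears the denominator of M and leaves D applied to F(w,x)/F(0,x).\<close>

lemma M_op_eq:
  assumes "F \<in> P_group"
  shows "fps_const ratfun_w * M_op F = theta_ratfun (emb_w (inverse (at_w0 F)) * F)"
proof -
  define f where "f = at_w0 F"
  have f0: "fps_nth f 0 = 1" using assms by (simp add: f_def at_w0_nth_0)
  have e0: "fps_nth (emb_w f) 0 = 1" by (simp add: emb_w_def f0)
  have "f * inverse f = 1" using f0 by (simp add: inverse_mult_eq_1')
  hence "emb_w f * emb_w (inverse f) = 1" by (simp flip: emb_w_mult)
  hence "F / emb_w f = emb_w (inverse f) * F"
    using e0 by (simp add: fps_divide_unit fps_inverse_unique mult.commute)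
  moreover have "ratfun_w \<noteq> 0" by (simp add: ratfun_w_def)
  ultimately show ?thesis
    by (intro fps_ext) (simp add: M_op_def Let_def theta_ratfun_def f_def ring_distribs mult.assoc)
qed

lemma M_op_iter_in_P_group: "n > 0 \<Longrightarrow> (M_op ^^ p) (F_ser n) \<in> P_group"
  by (induction p) (simp_all add: F_ser_in_P_group M_op_in_P_group)

text \<open>The symbol of \<open>w\<^sup>p M\<^sup>p\<close>.\<close>
fun M_symbol :: "nat \<Rightarrow> nat \<Rightarrow> rat poly fps" where
  "M_symbol n 0 = 1"
| "M_symbol n (Suc p) = theta_w (fps_lift (inverse (I_ser n p)) * M_symbol n p)"

lemma op_apply_M_symbol:
  assumes "n > 0"
  shows "op_apply (M_symbol n p) (F_ser n) = fps_const (ratfun_w ^ p) * (M_op ^^ p) (F_ser n)"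
proof (induction p)
  case (Suc p)
  have "op_apply (M_symbol n (Suc p)) (F_ser n)
      = theta_ratfun (fps_const (ratfun_w ^ p) * (emb_w (inverse (I_ser n p)) * (M_op ^^ p) (F_ser n)))"
    by (simp add: op_apply_theta_w op_apply_lift_mult Suc mult.left_commute)
  also have "\<dots> = fps_const (ratfun_w ^ p) * (fps_const ratfun_w * M_op ((M_op ^^ p) (F_ser n)))"
    unfolding theta_ratfun_const_mult
    by (subst M_op_eq[OF M_op_iter_in_P_group[OF assms]]) (simp add: I_ser_def)
  finally show ?case by (simp add: mult.assoc [symmetric] mult.commute)
qed (simp add: op_apply_1)

lemma degree_fps_lift_mult:
  assumes "\<And>m. degree (fps_nth G m) \<le> k"
  shows "degree (fps_nth (fps_lift f * G) m) \<le> k"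
  unfolding fps_lift_mult_nth
  by (intro degree_sum_le finite_atLeastAtMost order_trans[OF degree_smult_le] assms)

lemma coeff_fps_lift_mult:
  assumes "\<And>m. coeff (fps_nth G m) k = fps_nth g m"
  shows "coeff (fps_nth (fps_lift f * G) m) k = fps_nth (f * g) m"
  unfolding fps_lift_mult_nth by (simp add: coeff_sum fps_mult_nth assms)

lemma degree_M_symbol: "degree (fps_nth (M_symbol n p) m) \<le> p"
proof (induction p arbitrary: m)
  case (Suc p)
  have "degree (fps_nth (M_symbol n (Suc p)) m)
      \<le> degree [:of_nat m, 1::rat:] + degree (fps_nth (fps_lift (inverse (I_ser n p)) * M_symbol n p) m)"
    unfolding M_symbol.simps theta_w_nth by (rule degree_mult_le)
  also have "\<dots> \<le> Suc p"
    using degree_fps_lift_mult[OF Suc, of "inverse (I_ser n p)" m] by simp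
  finally show ?case .
qed simp

text \<open>Each D is monic in w, so the leading coefficient only collects the series 1/I_q.\<close>

lemma coeff_M_symbol: "coeff (fps_nth (M_symbol n p) m) p = fps_nth (\<Prod>q<p. inverse (I_ser n q)) m"
proof (induction p arbitrary: m)
  case (Suc p)
  let ?G = "fps_lift (inverse (I_ser n p)) * M_symbol n p"
  have "coeff (fps_nth ?G m) (Suc p) = 0"
    using degree_fps_lift_mult[OF degree_M_symbol] by (intro coeff_eq_0) (simp add: le_imp_less_Suc)
  hence "coeff (fps_nth (M_symbol n (Suc p)) m) (Suc p) = coeff (fps_nth ?G m) p"
    by (simp add: theta_w_nth)
  also have "\<dots> = fps_nth (inverse (I_ser n p) * (\<Prod>q<p. inverse (I_ser n q))) m"
    by (rule coeff_fps_lift_mult[OF Suc])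
  finally show ?case by (simp add: mult.commute)
qed (simp add: coeff_1 if_distrib)

lemma M_symbol_nth_0: "n > 0 \<Longrightarrow> fps_nth (M_symbol n p) 0 = [:0, 1:] ^ p"
  by (induction p) (simp_all add: theta_w_nth I_ser_nth_0 flip: one_pCons)

text \<open>\<open>M_symbol\<close> starts with D on the left, so one more series completes a chain;
  later iterates act further left, hence \<open>rev\<close>.\<close>

lemma lift_mult_M_symbol_eq_op_chain:
  "fps_lift (inverse (I_ser n p)) * M_symbol n p = op_chain (map (\<lambda>q. inverse (I_ser n q)) (rev [0..<Suc p]))"
proof (induction p)
  case (Suc p)
  have "op_chain (map (\<lambda>q. inverse (I_ser n q)) (rev [0..<Suc (Suc p)])) =
     fps_lift (inverse (I_ser n (Suc p))) * theta_w (op_chain (map (\<lambda>q. inverse (I_ser n q)) (rev [0..<Suc p])))"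
    by simp
  thus ?case by (simp only: Suc[symmetric] M_symbol.simps)
qed simp

section \<open>The hypergeometric equation\<close>

text \<open>The symbol of the hypergeometric operator \<open>L\<close> with its left factor \<open>D\<close> removed.\<close>
definition hyp_symbol :: "nat \<Rightarrow> rat poly fps" where
  "hyp_symbol n = Abs_fps (\<lambda>m. if m = 0 then [:0, 1:] ^ (n - 1)
     else if m = 1 then smult (- of_nat n) (\<Prod>j=1..<n. [:of_nat j, of_nat n:]) else 0)"

text \<open>The restored D contributes w + 1 to the x term, and n (w + 1) is the missing factor nw +
  n.\<close>

lemma theta_hyp_symbol_nth:
  assumes "n > 0"
  shows "fps_nth (theta_w (hyp_symbol n)) m = (if m = 0 then [:0, 1:] ^ n
     else if m = 1 then - (\<Prod>j=1..n. [:of_nat j, of_nat n:]) else 0)"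
proof -
  obtain k where k: "n = Suc k" using assms by (cases n) auto
  have eq: "[:1, 1:] * smult (- of_nat n) (\<Prod>j=1..<n. [:of_nat j, of_nat n:]) = - (\<Prod>j=1..n. [:of_nat j, of_nat n :: rat:])"
  proof -
    have "(\<Prod>j=1..n. [:of_nat j, of_nat n :: rat:]) = (\<Prod>j=1..<n. [:of_nat j, of_nat n:]) * [:of_nat n, of_nat n:]"
      using assms by (simp add: prod.last_plus mult.commute k atLeastLessThanSuc_atLeastAtMost)
    also have "[:of_nat n, of_nat n:] = smult (of_nat n) [:1, 1::rat:]" by simp
    finally show ?thesis by (simp only: mult_smult_left mult_smult_right smult_minus_left mult_minus_right mult.commute)
  qed
  show ?thesis unfolding theta_w_nth hyp_symbol_def using eq by (simp add: k del: mult_pCons_left)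
qed

lemma F_ser_rec:
  assumes "n > 0"
  shows "fps_nth (F_ser n) (Suc k) * ((ratfun_w + of_nat (Suc k)) ^ n - ratfun_w ^ n)
       = fps_nth (F_ser n) k * (\<Prod>j=1..n. of_nat n * ratfun_w + of_nat (n * k + j))"
proof -
  define a where "a r = of_nat n * ratfun_w + of_nat r" for r
  define b where "b r = (ratfun_w + of_nat r) ^ n - ratfun_w ^ n" for r
  \<comment> \<open>The value at w = 0 is r^n.\<close>
  have b: "b r \<noteq> 0" if "r > 0" for r
  proof -
    have "eval0 (b r) = of_nat r ^ n"
      using assms by (simp add: b_def regular0_add regular0_diff regular0_power)
    thus ?thesis using that by auto
  qed
  have "(\<Prod>r=1..n * k + n. a r) = (\<Prod>r=1..n * k. a r) * (\<Prod>r=n*k+1..n*k+n. a r)"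
    by (intro prod.ub_add_nat) simp
  also have "(\<Prod>r=n*k+1..n*k+n. a r) = (\<Prod>j=1..n. a (n * k + j))"
    using prod.shift_bounds_cl_nat_ivl[of a 1 "n * k" n] by (simp add: add.commute)
  finally have a: "(\<Prod>r=1..n * Suc k. a r) = (\<Prod>r=1..n * k. a r) * (\<Prod>j=1..n. a (n * k + j))"
    by (simp add: add.commute)
  have "fps_nth (F_ser n) m = (\<Prod>r=1..n*m. a r) / (\<Prod>r=1..m. b r)" for m
    by (simp add: F_ser_def a_def b_def)
  moreover have "(\<Prod>r=1..Suc k. b r) = (\<Prod>r=1..k. b r) * b (Suc k)" by simp
  ultimately have "fps_nth (F_ser n) (Suc k) * b (Suc k) = fps_nth (F_ser n) k * (\<Prod>j=1..n. a (n * k + j))"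
    using a b[of "Suc k"] by simp
  thus ?thesis by (simp add: a_def b_def)
qed

text \<open>Only x^0 and x^1 occur in the operator, so each coefficient identity is the two-term
  recurrence \<open>F_ser_rec\<close>.\<close>

lemma op_apply_theta_hyp_symbol:
  assumes "n > 0"
  shows "op_apply (theta_w (hyp_symbol n)) (F_ser n) = fps_const (ratfun_w ^ n) * F_ser n"
proof (rule fps_ext)
  fix m
  let ?L = "theta_w (hyp_symbol n)"
  have lin: "to_fract [:of_nat m, 1:] = ratfun_w + of_nat m" for m
    using to_fract_linear[of m 1] by simp
  have L0: "to_fract (pcompose (fps_nth ?L 0) [:of_nat m, 1:]) = (ratfun_w + of_nat m) ^ n" for m
    using assms by (simp add: theta_hyp_symbol_nth pcompose_power pcompose_pCons to_fract_power lin)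
  have L1: "to_fract (pcompose (fps_nth ?L 1) [:of_nat k, 1:]) = - (\<Prod>j=1..n. of_nat n * ratfun_w + of_nat (n * k + j))" for k
  proof -
    have "pcompose [:of_nat j, of_nat n:] [:of_nat k, 1:] = [:of_nat (n * k + j), of_nat n :: rat:]" for j
      by (simp add: pcompose_pCons)
    moreover have "fps_nth ?L 1 = - (\<Prod>j=1..n. [:of_nat j, of_nat n:])"
      using assms by (simp add: theta_hyp_symbol_nth)
    ultimately show ?thesis
      by (simp only: pcompose_uminus pcompose_prod to_fract_uminus to_fract_prod to_fract_linear)
  qed
  show "fps_nth (op_apply ?L (F_ser n)) m = fps_nth (fps_const (ratfun_w ^ n) * F_ser n) m"
  proof (cases m)
    case 0
    thus ?thesis using L0[of 0] by (simp add: op_apply_nth)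
  next
    case (Suc k)
    have "(\<Sum>j=0..k. fps_nth (F_ser n) j * to_fract (pcompose (fps_nth ?L (m - j)) [:of_nat j, 1:]))
        = (\<Sum>j=0..k. if j = k then fps_nth (F_ser n) k * to_fract (pcompose (fps_nth ?L 1) [:of_nat k, 1:]) else 0)"
      using assms by (intro sum.cong refl) (auto simp: theta_hyp_symbol_nth Suc)
    hence "fps_nth (op_apply ?L (F_ser n)) m =
       fps_nth (F_ser n) k * to_fract (pcompose (fps_nth ?L 1) [:of_nat k, 1:]) + fps_nth (F_ser n) m * (ratfun_w + of_nat m) ^ n"
      by (simp add: op_apply_nth Suc L0 sum.atLeast0_atMost_Suc flip: of_nat_Suc)
    also have "\<dots> = fps_nth (F_ser n) m * ratfun_w ^ n"
      using F_ser_rec[OF assms, of k] unfolding L1 Suc by (simp add: algebra_simps)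
    finally show ?thesis by (simp add: mult.commute)
  qed
qed

section \<open>Comparison of M^n with the hypergeometric operator\<close>

lemma prod_linear:
  fixes c :: rat
  assumes "c \<noteq> 0"
  shows "degree (\<Prod>j=1..n. [:of_nat j, c:]) = n" and "coeff (\<Prod>j=1..n. [:of_nat j, c:]) n = c ^ n"
proof -
  show d: "degree (\<Prod>j=1..n. [:of_nat j, c:]) = n"
    using assms by (subst degree_prod_eq_sum_degree) auto
  have "lead_coeff (\<Prod>j=1..n. [:of_nat j, c:]) = c ^ n"
    using assms by (subst lead_coeff_prod) simp
  thus "coeff (\<Prod>j=1..n. [:of_nat j, c:]) n = c ^ n" by (simp only: d)
qed

lemma fps_prod_zeroth: "fps_nth (\<Prod>i\<in>A. f i) 0 = (\<Prod>i\<in>A. fps_nth (f i) 0)"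
  for f :: "'a \<Rightarrow> rat fps"
  by (induction A rule: infinite_finite_induct) auto

lemma hyp_symbol_factorization:
  assumes n: "n > 0"
  shows "(1 - fps_const (of_nat n ^ n) * fps_X) * (\<Prod>p<n. I_ser n p) = 1" (is "?h = 1")
    and "hyp_symbol n = op_chain (map (\<lambda>q. inverse (I_ser n q)) (rev [0..<n]))"
proof -
  obtain k where k: "n = Suc k" using n by (cases n) auto
  let ?L = "theta_w (hyp_symbol n)"
  define G where "G = fps_lift ?h * M_symbol n n - ?L"
  have I0: "fps_nth (I_ser n p) 0 = 1" for p using I_ser_nth_0[OF n] .
  have "(\<Prod>p<n. I_ser n p) * (\<Prod>p<n. inverse (I_ser n p)) = 1"
    by (simp add: inverse_mult_eq_1' I0 flip: prod.distrib)
  hence prod: "?h * (\<Prod>p<n. inverse (I_ser n p)) = 1 - fps_const (of_nat n ^ n) * fps_X"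
    by (simp add: mult.assoc)
  \<comment> \<open>The factor h is chosen so that both operators have leading coefficient 1 - n^n x
    in w.\<close>
  have deg: "degree (fps_nth G m) < n" for m
  proof -
    have "degree (fps_nth ?L m) \<le> n"
      using n prod_linear(1)[of "of_nat n" n] by (simp add: theta_hyp_symbol_nth degree_linear_power[of 0, simplified])
    hence "degree (fps_nth G m) \<le> n"
      unfolding G_def using degree_fps_lift_mult[OF degree_M_symbol, of ?h n n m]
      by (simp add: degree_diff_le)
    moreover have "coeff (fps_nth ?L m) n = fps_nth (1 - fps_const (of_nat n ^ n) * fps_X) m"
      using n prod_linear(2)[of "of_nat n" n] by (simp add: theta_hyp_symbol_nth coeff_linear_power)
    hence "coeff (fps_nth G m) n = 0"
      unfolding G_def using coeff_fps_lift_mult[OF coeff_M_symbol, of ?h n n m] prod by simp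
    ultimately show ?thesis using n
      by (metis degree_0 leading_coeff_0_iff le_neq_implies_less)
  qed
  have "op_apply G (F_ser n) = fps_const (ratfun_w ^ n) * (emb_w ?h * (M_op ^^ n) (F_ser n) - F_ser n)"
    unfolding G_def using n
    by (simp only: op_apply_diff op_apply_lift_mult op_apply_M_symbol op_apply_theta_hyp_symbol ring_distribs mult.left_commute)
  moreover have "regular0 (fps_nth (emb_w ?h * (M_op ^^ n) (F_ser n) - F_ser n) m)" for m
  proof -
    have P: "regular0 (fps_nth (F_ser n) d)" "regular0 (fps_nth ((M_op ^^ n) (F_ser n)) d)" for d
      using F_ser_in_P_group[OF n] M_op_iter_in_P_group[OF n] by (auto simp: P_group_def)
    have "regular0 (fps_nth (emb_w ?h) d)" for d by (simp add: emb_w_def)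
    hence "regular0 (fps_nth (emb_w ?h * (M_op ^^ n) (F_ser n)) m)"
      using P by (intro regular0_fps_mult)
    thus ?thesis using P regular0_diff by simp
  qed
  ultimately have "G = 0"
    using F_ser_in_P_group[OF n] deg
    by (intro op_apply_eq_O_imp_zero[where F = "F_ser n" and n = n]) (auto simp: P_group_def)
  \<comment> \<open>Unfolding the last step of \<open>M_symbol\<close> exposes the leftmost D on the
    right-hand side too.\<close>
  hence eq: "?L = fps_lift ?h * theta_w (fps_lift (inverse (I_ser n k)) * M_symbol n k)"
    unfolding G_def by (simp add: k)
  have h0: "fps_nth ?h 0 = 1" by (simp add: fps_prod_zeroth I0)
  have G0: "fps_nth (fps_lift (inverse (I_ser n k)) * M_symbol n k) 0 = [:0, 1:] ^ k"
    using n by (simp add: M_symbol_nth_0 I0 flip: one_pCons)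
  show "?h = 1" using theta_w_left_factor_unique(1)[OF eq h0 G0] .
  show "hyp_symbol n = op_chain (map (\<lambda>q. inverse (I_ser n q)) (rev [0..<n]))"
    using theta_w_left_factor_unique(2)[OF eq h0 G0] lift_mult_M_symbol_eq_op_chain[of n k] k by simp
qed

section \<open>Self-adjointness and symmetry\<close>

text \<open>In the x term, replacing w by -w - 1 sends nw + j to -(nw + n - j), so the n - 1 factors
  are permuted up to sign.\<close>

lemma adjoint_hyp_symbol:
  assumes "n > 0"
  shows "adjoint_op (hyp_symbol n) = fps_const [:(- 1) ^ (n - 1):] * hyp_symbol n"
proof (rule fps_ext)
  fix m
  have m0: "pcompose ([:0, 1:] ^ k) [:0, -1:] = smult ((- 1) ^ k) ([:0, 1:] ^ k :: rat poly)" for k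
  proof -
    have "pcompose ([:0, 1:] ^ k) [:0, -1:] = (smult (-1) [:0, 1::rat:]) ^ k"
      by (simp add: pcompose_power pcompose_pCons)
    thus ?thesis by (simp only: smult_power)
  qed
  have "pcompose (\<Prod>j=1..<n. [:of_nat j, of_nat n:]) [:-1, -1:] = (\<Prod>j=1..<n. smult (-1) [:of_nat (n - j), of_nat n :: rat:])"
    unfolding pcompose_prod by (intro prod.cong refl) (simp add: pcompose_pCons of_nat_diff)
  also have "\<dots> = smult ((- 1) ^ (n - 1)) (\<Prod>j=1..<n. [:of_nat (n - j), of_nat n:])"
    unfolding prod_smult by simp
  also have "(\<Prod>j=1..<n. [:of_nat (n - j), of_nat n :: rat:]) = (\<Prod>j=1..<n. [:of_nat j, of_nat n:])"
    by (rule prod.reindex_bij_witness[of _ "\<lambda>j. n - j" "\<lambda>j. n - j"]) auto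
  finally have m1: "pcompose (\<Prod>j=1..<n. [:of_nat j, of_nat n:]) [:-1, -1:]
      = smult ((- 1) ^ (n - 1)) (\<Prod>j=1..<n. [:of_nat j, of_nat n :: rat:])" .
  show "fps_nth (adjoint_op (hyp_symbol n)) m = fps_nth (fps_const [:(- 1) ^ (n - 1):] * hyp_symbol n) m"
    using m0 m1 by (simp add: adjoint_op_nth hyp_symbol_def pcompose_smult pcompose_uminus mult.commute)
qed

lemma I_ser_symmetric:
  assumes n: "n > 0" and p: "p < n"
  shows "I_ser n p = I_ser n (n - 1 - p)"
proof -
  define J where "J = (\<lambda>q. inverse (I_ser n q))"
  obtain k where k: "n = Suc k" using n by (cases n) auto
  have fact: "hyp_symbol n = op_chain (map J (rev [0..<n]))"
    using hyp_symbol_factorization(2)[OF n] by (simp add: J_def)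
  have list: "map J (rev [0..<n]) = J k # map J (rev [0..<k])" by (simp add: k)
  \<comment> \<open>Two values of the adjoint: by self-adjointness, and by reversing a chain with k
    copies of D.\<close>
  have "fps_const [:(- 1) ^ k:] * op_chain (map J (rev [0..<n]))
      = fps_const [:(- 1) ^ k:] * op_chain (rev (map J (rev [0..<n])))"
    using adjoint_hyp_symbol[OF n] adjoint_op_chain[of "J k" "map J (rev [0..<k])"]
    unfolding fact list[symmetric] by (simp add: k)
  hence "op_chain (map J (rev [0..<n])) = op_chain (rev (map J (rev [0..<n])))"
    by simp
  hence "map J (rev [0..<n]) = rev (map J (rev [0..<n]))"
    by (rule op_chain_inject) (simp_all add: J_def I_ser_nth_0 n)
  hence "map J (rev [0..<n]) ! p = map J [0..<n] ! p"
    by (simp add: rev_map)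
  hence "J (n - 1 - p) = J p"
    using p by (simp add: rev_nth)
  thus ?thesis unfolding J_def
    by (metis I_ser_nth_0 fps_inverse_idempotent n zero_neq_one)
qed

section \<open>Binomial series and the product formulas\<close>

lemma one_minus_pow_add: "one_minus_pow c (a + b) = one_minus_pow c a * one_minus_pow c b"
  by (simp add: one_minus_pow_def fps_binomial_add_mult fps_compose_mult_distrib)

lemma one_minus_pow_1: "one_minus_pow c 1 = 1 - fps_const c * fps_X"
  by (simp add: one_minus_pow_def fps_binomial_1 fps_compose_add_distrib)

lemma one_minus_pow_0: "one_minus_pow c 0 = 1"
  by (simp add: one_minus_pow_def)

lemma one_minus_pow_nth_0: "fps_nth (one_minus_pow c a) 0 = 1"
  by (simp add: one_minus_pow_def)

lemma one_minus_pow_power: "one_minus_pow c a ^ k = one_minus_pow c (of_nat k * a)"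
  by (induction k) (simp_all add: one_minus_pow_0 one_minus_pow_add ring_distribs)

text \<open>In a domain f = g or f = -g, and f + g has constant term 2.\<close>

lemma fps_square_inject:
  fixes f g :: "rat fps"
  assumes "f * f = g * g" "fps_nth f 0 = 1" "fps_nth g 0 = 1"
  shows "f = g"
proof -
  have "f + g \<noteq> 0"
  proof
    assume "f + g = 0"
    hence "fps_nth (f + g) 0 = 0" by simp
    thus False using assms by simp
  qed
  moreover have "(f - g) * (f + g) = 0" using assms(1) by (simp add: algebra_simps)
  ultimately show ?thesis by simp
qed

theorem theorem2:
  fixes n :: nat
  assumes "n > 0"
  shows "(\<forall>p<n. fps_nth (I_ser n p) 0 = 1)
    \<and> (\<Prod>p<n. I_ser n p) = one_minus_pow (of_nat n ^ n) (- 1)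
    \<and> (\<Prod>p<n. I_ser n p ^ (n - 1 - p)) = one_minus_pow (of_nat n ^ n) (- ((of_nat n - 1) / 2))
    \<and> (\<forall>p<n. I_ser n p = I_ser n (n - 1 - p))"
proof -
  let ?c = "of_nat n ^ n :: rat"
  let ?Q = "\<Prod>p<n. I_ser n p ^ (n - 1 - p)"
  let ?b = "one_minus_pow ?c (- ((of_nat n - 1) / 2))"
  have I0: "fps_nth (I_ser n p) 0 = 1" for p using I_ser_nth_0[OF assms] .
  have symmetric: "I_ser n p = I_ser n (n - 1 - p)" if "p < n" for p
    using I_ser_symmetric[OF assms that] .
  have "one_minus_pow ?c 1 * (\<Prod>p<n. I_ser n p) = one_minus_pow ?c 1 * one_minus_pow ?c (- 1)"
  proof -
    have "one_minus_pow ?c 1 * one_minus_pow ?c (- 1) = 1"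
      by (simp add: one_minus_pow_0 flip: one_minus_pow_add)
    thus ?thesis using hyp_symbol_factorization(1)[OF assms] by (simp add: one_minus_pow_1)
  qed
  moreover have "one_minus_pow ?c 1 \<noteq> 0"
    using one_minus_pow_nth_0[of ?c 1] by auto
  ultimately have prod: "(\<Prod>p<n. I_ser n p) = one_minus_pow ?c (- 1)" by simp
  \<comment> \<open>Reindexing by p to n - 1 - p and applying the symmetry turns the exponent n - 1
    - p into p; the two exponents add up to n - 1.\<close>
  have "?Q = (\<Prod>p<n. I_ser n (n - Suc p) ^ (n - 1 - (n - Suc p)))"
    by (rule prod.nat_diff_reindex[symmetric])
  also have "\<dots> = (\<Prod>p<n. I_ser n p ^ p)"
  proof (intro prod.cong refl)
    fix p assume "p \<in> {..<n}"
    thus "I_ser n (n - Suc p) ^ (n - 1 - (n - Suc p)) = I_ser n p ^ p"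
      using symmetric[of p] by simp
  qed
  finally have Q: "?Q = (\<Prod>p<n. I_ser n p ^ p)" .
  have "?Q * ?Q = ?Q * (\<Prod>p<n. I_ser n p ^ p)"
    by (rule arg_cong[OF Q, where f = "(*) ?Q"])
  also have "\<dots> = (\<Prod>p<n. I_ser n p ^ (n - 1 - p) * I_ser n p ^ p)"
    by (rule prod.distrib[symmetric])
  also have "\<dots> = (\<Prod>p<n. I_ser n p) ^ (n - 1)"
    unfolding prod_power_distrib power_add[symmetric] by (intro prod.cong refl) auto
  also have "\<dots> = one_minus_pow ?c (- (of_nat n - 1))"
    unfolding prod one_minus_pow_power using assms by (simp add: of_nat_diff)
  also have "\<dots> = ?b * ?b"
    by (simp flip: one_minus_pow_add)
  finally have "?Q = ?b"
    by (rule fps_square_inject) (simp_all add: fps_prod_zeroth fps_nth_power_0 I0 one_minus_pow_nth_0)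
  with I0 prod symmetric show ?thesis by blast
qed

end
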